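(* Let $f=\sec(2x)$ and $g=2\tan(2x)$, and let $D=d/dx$. For every integer $n\ge 1$, $$D^n(f)=\sum_{k=0}^{\lfloor n/2\rfloor}b(n,k)\,f^{2k+1}g^{n-2k},$$ $$D^n(g)=2^{n+1}\sum_{k=0}^{\lfloor (n-1)/2\rfloor}a(n,k)\,f^{2k+2}g^{n-1-2k},$$ $$(fD)^n(f)=n!\sum_{k=0}^{\lfloor n/2\rfloor}H(n,k)\,f^{n+1+2k}g^{n-2k},$$ $$(fD)^n(g)=2(n+1)!\sum_{k=0}^{\lfloor (n-1)/2\rfloor}F(n,k)\,f^{n+2+2k}g^{n-1-2k}.$$
   Context: The functions $f,g$ are functions of the real variable $x$ (where $\cos 2x\neq 0$); they satisfy $D(f)=fg$ and $D(g)=4f^2$. The operator $fD$ sends a function $\phi$ to $f\cdot D(\phi)$, and $(fD)^{n+1}(\phi)=f\,D\big((fD)^n(\phi)\big)$. The convention $g^0=1$ is used. Numbers $a(n,k)$: for a permutation $\pi$ of $[n]=\{1,\dots,n\}$ let $\mathrm{des}(\pi)=\#\{1\le i\le n-1:\pi(i)>\pi(i+1)\}$, and let $A_n(x)=\sum_{\pi\in\mathfrak S_n}x^{\mathrm{des}(\pi)}$ be the Eulerian polynomial. For $n\ge1$, the numbers $a(n,k)$ (the $\gamma$-vector of the type $A$ Coxeter complex) are the uniquely determined coefficients in $$A_n(x)=\sum_{k=0}^{\lfloor (n-1)/2\rfloor}a(n,k)x^k(1+x)^{n-1-2k}$$ (such an expansion exists). Numbers $b(n,k)$: let $B_n$ be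 the group of signed permutations, i.e. bijections $\pi$ of $\{\pm1,\dots,\pm n\}$ with $\pi(-i)=-\pi(i)$; put $\pi(0)=0$, $\mathrm{des}_B(\pi)=\#\{i\in\{0,1,\dots,n-1\}:\pi(i)>\pi(i+1)\}$, and $B_n(x)=\sum_{\pi\in B_n}x^{\mathrm{des}_B(\pi)}$. For $n\ge 1$, the numbers $b(n,k)$ (the $\gamma$-vector of the type $B$ Coxeter complex) are the uniquely determined coefficients in $$B_n(x)=\sum_{k=0}^{\lfloor n/2\rfloor}b(n,k)x^k(1+x)^{n-2k}$$ (such an expansion exists). Numbers $F(n,k)$ and $H(n,k)$ (the $\gamma$-vectors of the type $A$ and type $B$ associahedra): $F(n,k)=C_k\binom{n-1}{2k}$ with $C_k=\frac1{k+1}\binom{2k}{k}$, and $H(n,k)=\binom{2k}{k}\binom{n}{2k}$. *)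

theory Defs
  imports "HOL-Analysis.Derivative" "HOL-Combinatorics.Permutations"
    "HOL-Computational_Algebra.Polynomial"
begin

definition des_A :: "nat \<Rightarrow> (nat \<Rightarrow> nat) \<Rightarrow> nat" where
  "des_A n p = card {i \<in> {1..<n}. p i > p (i + 1)}"

definition eulerian_A :: "nat \<Rightarrow> real poly" where
  "eulerian_A n = (\<Sum>p | p permutes {1..n}. monom 1 (des_A n p))"

text \<open>A signed permutation is a function on all integers which is the identity outside
  $\{\pm 1, \dots, \pm n\}$; in particular it maps 0 to 0, as the definition of type B descents
  requires.\<close>

definition signed_perms :: "nat \<Rightarrow> (int \<Rightarrow> int) set" where
  "signed_perms n = {p. p permutes ({- int n..int n} - {0}) \<and>
                        (\<forall>i \<in> {- int n..int n} - {0}. p (- i) = - p i)}"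

definition des_B :: "nat \<Rightarrow> (int \<Rightarrow> int) \<Rightarrow> nat" where
  "des_B n p = card {i \<in> {0..<int n}. p i > p (i + 1)}"

definition eulerian_B :: "nat \<Rightarrow> real poly" where
  "eulerian_B n = (\<Sum>p \<in> signed_perms n. monom 1 (des_B n p))"

text \<open>The coefficients of a polynomial in the basis $x^k (1+x)^{d-2k}$, $0 \le k \le d/2$,
  extended by 0 to all indices so that the coefficient function is unique.\<close>

definition gamma_vector :: "nat \<Rightarrow> real poly \<Rightarrow> nat \<Rightarrow> real" where
  "gamma_vector d q = (THE c. (\<forall>k > d div 2. c k = 0) \<and>
     q = (\<Sum>k = 0..d div 2. smult (c k) (monom 1 k * [:1, 1:] ^ (d - 2 * k))))"

definition gamma_a :: "nat \<Rightarrow> nat \<Rightarrow> real" where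
  "gamma_a n = gamma_vector (n - 1) (eulerian_A n)"

definition gamma_b :: "nat \<Rightarrow> nat \<Rightarrow> real" where
  "gamma_b n = gamma_vector n (eulerian_B n)"

definition catalan_number :: "nat \<Rightarrow> real" where
  "catalan_number k = 1 / real (k + 1) * real ((2 * k) choose k)"

definition gamma_F :: "nat \<Rightarrow> nat \<Rightarrow> real" where
  "gamma_F n k = catalan_number k * real ((n - 1) choose (2 * k))"

definition gamma_H :: "nat \<Rightarrow> nat \<Rightarrow> real" where
  "gamma_H n k = real ((2 * k) choose k) * real (n choose (2 * k))"

definition mult_deriv :: "(real \<Rightarrow> real) \<Rightarrow> (real \<Rightarrow> real) \<Rightarrow> real \<Rightarrow> real" where
  "mult_deriv f \<phi> = (\<lambda>x. f x * deriv \<phi> x)"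

end

theory Submission
  imports Defs
begin

text \<open>Since $D(f) = fg$ and $D(g) = 4f^2$, applying $D$ or $fD$ to $f^{a+2k} g^{n-2k}$ yields
  $(a+2k)$ times the $k$-th and $4(n-2k)$ times the $(k+1)$-st monomial of the next level. So each
  of the four identities amounts to a triangular recurrence for its coefficients. For $H$ and $F$
  the recurrence is a binomial identity. For $b$ and $a$ it is the image, in the basis
  $x^k(1+x)^{n-2k}$, of the Eulerian recurrences
  $B_{n+1} = (1+(2n+1)x)B_n + 2x(1-x)B_n'$ and $A_{n+1} = (1+nx)A_n + x(1-x)A_n'$, which come from
  inserting the letters of absolute value $n+1$ into the word $0\,\pi(1)\dots\pi(n)$.\<close>

section \<open>Descents of a word under insertion of an extreme letter\<close>

fun list_des :: "int list \<Rightarrow> nat" where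
  "list_des (x # y # zs) = (if x > y then 1 else 0) + list_des (y # zs)"
| "list_des _ = 0"

lemma list_des_conv_card: "list_des l = card {i. Suc i < length l \<and> l ! i > l ! Suc i}"
proof (induction l rule: list_des.induct)
  case (1 x y zs)
  let ?A = "{i. Suc i < length (y # zs) \<and> (y # zs) ! i > (y # zs) ! Suc i}"
  have eq: "{i. Suc i < length (x # y # zs) \<and> (x # y # zs) ! i > (x # y # zs) ! Suc i}
      = (if x > y then {0} else {}) \<union> Suc ` ?A" (is "?L = ?R")
  proof (rule set_eqI)
    fix i show "i \<in> ?L \<longleftrightarrow> i \<in> ?R"
      by (cases i) auto
  qed
  have "finite ?A" by simp
  then show ?case
    unfolding eq by (simp add: card_image 1)
qed auto

text \<open>A greatest letter is always followed by a descent and never preceded by one. Hence a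
  descent gap or the end of the word keeps the number of descents, while every other gap raises it
  by one. The weight \<open>h\<close> is arbitrary so that the induction can absorb the comparison
  of the first two letters into it.\<close>

lemma sum_list_des_insert_greatest:
  fixes h :: "nat \<Rightarrow> real"
  assumes "\<forall>y \<in> set (c # l). y < M"
  shows "(\<Sum>j\<le>length l. h (list_des (c # take j l @ M # drop j l))) =
    (1 + real (list_des (c # l))) * h (list_des (c # l)) +
    (real (length l) - real (list_des (c # l))) * h (Suc (list_des (c # l)))"
  using assms
proof (induction l arbitrary: c h)
  case Nil
  then show ?case by simp
next
  case (Cons a l)
  let ?e = "if c > a then 1 else (0::nat)"
  show ?case
    using Cons.prems Cons.IH[of a "\<lambda>d. h (?e + d)"]
    by (simp add: sum.atMost_Suc_shift del: sum.atMost_Suc) (auto simp: algebra_simps)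
qed

text \<open>Dual count: a least letter is preceded by a descent and never followed by one. Descent
  gaps still cost nothing, but the end of the word now adds a descent.\<close>

lemma sum_list_des_insert_least:
  fixes h :: "nat \<Rightarrow> real"
  assumes "\<forall>y \<in> set (c # l). M < y"
  shows "(\<Sum>j\<le>length l. h (list_des (c # take j l @ M # drop j l))) =
    real (list_des (c # l)) * h (list_des (c # l)) +
    (real (length l) + 1 - real (list_des (c # l))) * h (Suc (list_des (c # l)))"
  using assms
proof (induction l arbitrary: c h)
  case Nil
  then show ?case by simp
next
  case (Cons a l)
  let ?e = "if c > a then 1 else (0::nat)"
  show ?case
    using Cons.prems Cons.IH[of a "\<lambda>d. h (?e + d)"]
    by (simp add: sum.atMost_Suc_shift del: sum.atMost_Suc) (auto simp: algebra_simps)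
qed

section \<open>Signed words and insertion of the letter of largest absolute value\<close>

text \<open>One-line notations; the sign set is $\{1\}$ for type A and $\{1,-1\}$ for type B. In both
  types descents are counted with a 0 put in front of the word, which adds none in type A.\<close>

definition signed_words :: "int set \<Rightarrow> nat \<Rightarrow> int list set" where
  "signed_words S n = {l. distinct (map abs l) \<and> abs ` set l = {1..int n} \<and> sgn ` set l \<subseteq> S}"

lemma signed_words_0: "signed_words S 0 = {[]}"
  by (auto simp: signed_words_def)

lemma length_signed_words:
  assumes "l \<in> signed_words S n" shows "length l = n"
proof -
  have "card (set (map abs l)) = length (map abs l)"
    using assms by (intro distinct_card) (auto simp: signed_words_def)
  then show ?thesis
    using assms by (simp add: signed_words_def)
qed

lemma abs_signed_words:
  assumes "l \<in> signed_words S n" "y \<in> set l" shows "1 \<le> \<bar>y\<bar>" "\<bar>y\<bar> \<le> int n"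
  using assms by (auto simp: signed_words_def)

lemma finite_signed_words: "finite (signed_words S n)"
proof (rule finite_subset)
  show "signed_words S n \<subseteq> {l. set l \<subseteq> {- int n..int n} \<and> length l \<le> n}"
    using abs_signed_words length_signed_words by fastforce
  show "finite {l. set l \<subseteq> {- int n..int n} \<and> length l \<le> n}"
    by (rule finite_lists_length_le) simp
qed

text \<open>The inverse deletes the only letter of absolute value n+1 and remembers its sign and its
  place.\<close>

lemma bij_betw_insert_signed_words:
  assumes S: "S \<subseteq> {1, -1}"
  shows "bij_betw (\<lambda>(l, s, j). take j l @ (s * int (Suc n)) # drop j l)
    (signed_words S n \<times> S \<times> {..n}) (signed_words S (Suc n))"
proof -
  let ?M = "int (Suc n)"
  let ?F = "\<lambda>(l, s, j). take j l @ (s * ?M) # drop j l"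
  \<comment> \<open>The place of the large letter is the length of the prefix before it.\<close>
  let ?G = "\<lambda>z. let j = length (takeWhile (\<lambda>y. \<bar>y\<bar> \<noteq> ?M) z) in
    (filter (\<lambda>y. \<bar>y\<bar> \<noteq> ?M) z, sgn (z ! j), j)"
  have s: "s = 1 \<or> s = -1" if "s \<in> S" for s using S that by auto
  have small: "\<bar>y\<bar> \<noteq> ?M" if "l \<in> signed_words S n" "y \<in> set l" for l y
    using abs_signed_words[OF that] by simp
  have GF: "?G (?F (l, t, j)) = (l, t, j)" if l: "l \<in> signed_words S n" and t: "t \<in> S" and j: "j \<le> n" for l t j
  proof -
    have abst: "\<bar>t * ?M\<bar> = ?M" "sgn (t * ?M) = t" using s[OF t] by (auto simp: sgn_mult)
    have len: "length l = n" using length_signed_words[OF l] .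
    have tk: "\<forall>y \<in> set (take j l). \<bar>y\<bar> \<noteq> ?M" "\<forall>y \<in> set (drop j l). \<bar>y\<bar> \<noteq> ?M"
      using small[OF l] by (meson in_set_takeD in_set_dropD)+
    have "takeWhile (\<lambda>y. \<bar>y\<bar> \<noteq> ?M) (take j l @ (t * ?M) # drop j l) = take j l"
      using tk abst by (subst takeWhile_append2) auto
    moreover have "filter (\<lambda>y. \<bar>y\<bar> \<noteq> ?M) (take j l @ (t * ?M) # drop j l) = take j l @ drop j l"
      using tk abst by (simp only: filter_append filter.simps) (simp add: filter_True)
    ultimately show ?thesis
      using j len abst by (simp add: Let_def nth_append)
  qed
  have inj: "inj_on ?F (signed_words S n \<times> S \<times> {..n})"
  proof (rule inj_on_inverseI[where g = ?G])
    fix u assume u: "u \<in> signed_words S n \<times> S \<times> {..n}"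
    obtain l t j where "u = (l, t, j)" by (cases u)
    then show "?G (?F u) = u" using u GF[of l t j] by (simp only: mem_Sigma_iff atMost_iff)
  qed
  show ?thesis
  proof (rule bij_betwI')
    fix u v assume "u \<in> signed_words S n \<times> S \<times> {..n}" "v \<in> signed_words S n \<times> S \<times> {..n}"
    then show "(?F u = ?F v) = (u = v)" by (rule inj_on_eq_iff[OF inj])
  next
    fix u assume u: "u \<in> signed_words S n \<times> S \<times> {..n}"
    obtain l t j where ueq: "u = (l, t, j)" by (cases u)
    have l: "l \<in> signed_words S n" and t: "t \<in> S" using u ueq by auto
    have abst: "\<bar>t * ?M\<bar> = ?M" "sgn (t * ?M) = t" using s[OF t] by (auto simp: sgn_mult)
    let ?z = "take j l @ (t * ?M) # drop j l"
    \<comment> \<open>Up to order, insertion at \<open>j\<close> is the same as putting the letter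
      in front, and membership in \<open>signed_words\<close> does not depend on the order.\<close>
    have "mset l = mset (take j l) + mset (drop j l)"
      by (metis append_take_drop_id mset_append)
    then have mz: "mset ?z = mset ((t * ?M) # l)" by simp
    then have st: "set ?z = insert (t * ?M) (set l)" by (metis list.simps(15) mset_eq_setD)
    have "mset (map abs ?z) = mset (?M # map abs l)"
      unfolding mset_map mz by (simp add: abst(1)[simplified])
    moreover have "distinct (?M # map abs l)"
      using l small[OF l] by (fastforce simp: signed_words_def)
    ultimately have "distinct (map abs ?z)"
      using mset_eq_imp_distinct_iff by blast
    moreover have "abs ` set ?z = {1..?M}"
      using l abst(1) unfolding st image_insert by (auto simp: signed_words_def)
    moreover have "sgn ` set ?z \<subseteq> S"
      using l t abst(2) unfolding st by (auto simp: signed_words_def)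
    ultimately show "?F u \<in> signed_words S (Suc n)" unfolding ueq by (simp add: signed_words_def)
  next
    fix z assume z: "z \<in> signed_words S (Suc n)"
    then have "?M \<in> abs ` set z" by (simp add: signed_words_def)
    then obtain m where m: "m \<in> set z" "\<bar>m\<bar> = ?M" by auto
    then obtain xs ys where zeq: "z = xs @ m # ys" by (meson split_list)
    let ?l = "xs @ ys"
    have mm: "m = sgn m * ?M" using m(2) by (metis mult_sgn_abs mult.commute)
    have sm: "sgn m \<in> S" using z m by (auto simp: signed_words_def)
    have nm: "\<bar>m\<bar> \<notin> abs ` set ?l" and d: "distinct (map abs ?l)"
      using z zeq by (auto simp: signed_words_def)
    have "insert ?M (abs ` set ?l) = {1..?M}"
      using z m(2) unfolding zeq by (simp add: signed_words_def)
    then have "abs ` set ?l = {1..?M} - {?M}"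
      using nm unfolding m(2) by (metis Diff_insert_absorb)
    also have "\<dots> = {1..int n}" by auto
    finally have l: "?l \<in> signed_words S n" using z zeq d by (auto simp: signed_words_def)
    then have "length xs \<le> n" using length_signed_words[OF l] by simp
    then show "\<exists>u \<in> signed_words S n \<times> S \<times> {..n}. z = ?F u"
      using l sm zeq mm by (intro bexI[of _ "(?l, sgn m, length xs)"]) auto
  qed
qed

section \<open>Descent polynomials of signed words and the Eulerian recurrences\<close>

text \<open>For the sign sets \<open>{1}\<close> and \<open>{1, -1}\<close> these are the Eulerian
  polynomials of types A and B.\<close>

definition word_poly :: "int set \<Rightarrow> nat \<Rightarrow> real poly" where
  "word_poly S n = (\<Sum>l \<in> signed_words S n. monom 1 (list_des (0 # l)))"

lemma word_poly_0: "word_poly S 0 = 1"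
  by (simp add: word_poly_def signed_words_0)

lemma poly_word_poly: "poly (word_poly S n) y = (\<Sum>l \<in> signed_words S n. y ^ list_des (0 # l))"
  by (simp add: word_poly_def poly_sum poly_monom)

text \<open>The operator y d/dy multiplies a monomial by its exponent, here the number of descents.
  Keeping the factor \<open>y\<close> avoids exponents d-1.\<close>

lemma poly_pderiv_word_poly:
  "y * poly (pderiv (word_poly S n)) y
    = (\<Sum>l \<in> signed_words S n. real (list_des (0 # l)) * y ^ list_des (0 # l))"
proof -
  have pd: "pderiv (word_poly S n) = (\<Sum>l \<in> signed_words S n. pderiv (monom 1 (list_des (0 # l))))"
    unfolding word_poly_def by (induction rule: infinite_finite_induct) (simp_all add: pderiv_add)
  have "y * poly (pderiv (monom 1 d)) y = real d * y ^ d" for d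
    by (cases d) (simp_all add: pderiv_monom poly_monom)
  then show ?thesis
    by (simp add: pd poly_sum sum_distrib_left)
qed

text \<open>The inner sum runs to \<open>length l\<close>, which is n, in order to match the
  insertion lemmas.\<close>

lemma poly_word_poly_Suc:
  assumes "S \<subseteq> {1, -1}"
  shows "poly (word_poly S (Suc n)) y =
    (\<Sum>l \<in> signed_words S n. \<Sum>s \<in> S. \<Sum>j\<le>length l.
       y ^ list_des (0 # take j l @ (s * int (Suc n)) # drop j l))"
proof -
  have "poly (word_poly S (Suc n)) y = (\<Sum>(l, s, j) \<in> signed_words S n \<times> S \<times> {..n}.
       y ^ list_des (0 # take j l @ (s * int (Suc n)) # drop j l))"
    unfolding poly_word_poly
    by (subst sum.reindex_bij_betw[OF bij_betw_insert_signed_words[OF assms], symmetric])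
      (simp add: case_prod_unfold)
  also have "\<dots> = (\<Sum>l \<in> signed_words S n. \<Sum>s \<in> S. \<Sum>j\<le>n.
       y ^ list_des (0 # take j l @ (s * int (Suc n)) # drop j l))"
    by (simp add: sum.cartesian_product)
  finally show ?thesis
    by (simp add: length_signed_words cong: sum.cong)
qed

text \<open>A word with d descents contributes (1+d) y^d + (n-d) y^(d+1), which equals (1+ny) y^d +
  (1-y) d y^d; the last factor d y^d comes from the derivative.\<close>

lemma poly_word_poly_A_Suc:
  fixes y :: real
  shows "poly (word_poly {1} (Suc n)) y =
    (1 + n * y) * poly (word_poly {1} n) y + (1 - y) * (y * poly (pderiv (word_poly {1} n)) y)"
proof -
  have "(\<Sum>j\<le>length l. y ^ list_des (0 # take j l @ int (Suc n) # drop j l)) =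
     (1 + n * y) * y ^ list_des (0 # l) + (1 - y) * (real (list_des (0 # l)) * y ^ list_des (0 # l))"
    if l: "l \<in> signed_words {1} n" for l
  proof -
    have "\<forall>z \<in> set (0 # l). z < int (Suc n)" using abs_signed_words[OF l] by force
    from sum_list_des_insert_greatest[OF this, of "\<lambda>d. y ^ d"] show ?thesis
      by (simp add: length_signed_words[OF l] algebra_simps)
  qed
  then show ?thesis
    unfolding poly_word_poly_Suc[OF insert_mono[OF empty_subsetI]] poly_pderiv_word_poly
    unfolding poly_word_poly sum_distrib_left sum.distrib[symmetric]
    by (intro sum.cong refl) (simp del: of_nat_Suc)
qed

text \<open>The letters n+1 and -(n+1) are a greatest and a least letter. Together their insertions
  contribute (1+2d) y^d + (2n+1-2d) y^(d+1) for a word with d descents.\<close>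

lemma poly_word_poly_B_Suc:
  fixes y :: real
  shows "poly (word_poly {1, -1} (Suc n)) y =
    (1 + (2 * n + 1) * y) * poly (word_poly {1, -1} n) y
      + 2 * (1 - y) * (y * poly (pderiv (word_poly {1, -1} n)) y)"
proof -
  have "(\<Sum>j\<le>length l. y ^ list_des (0 # take j l @ int (Suc n) # drop j l))
      + (\<Sum>j\<le>length l. y ^ list_des (0 # take j l @ (- int (Suc n)) # drop j l)) =
     (1 + (2 * n + 1) * y) * y ^ list_des (0 # l)
      + 2 * (1 - y) * (real (list_des (0 # l)) * y ^ list_des (0 # l))"
    if l: "l \<in> signed_words {1, -1} n" for l
  proof -
    have "\<forall>z \<in> set (0 # l). z < int (Suc n)" "\<forall>z \<in> set (0 # l). - int (Suc n) < z"
      using abs_signed_words[OF l] by force+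
    from sum_list_des_insert_greatest[OF this(1), of "\<lambda>d. y ^ d"]
      sum_list_des_insert_least[OF this(2), of "\<lambda>d. y ^ d"] show ?thesis
      by (simp add: length_signed_words[OF l] algebra_simps)
  qed
  then show ?thesis
    unfolding poly_word_poly_Suc[OF order_refl] poly_pderiv_word_poly
    unfolding poly_word_poly sum_distrib_left sum.distrib[symmetric]
    by (intro sum.cong refl) (simp add: sum.distrib)
qed

section \<open>Permutations and signed permutations in one-line notation\<close>

lemma bij_betw_permutes_signed_words:
  "bij_betw (\<lambda>p. map (\<lambda>i. int (p i)) [1..<Suc n]) {p. p permutes {1..n}} (signed_words {1} n)"
proof (rule bij_betwI')
  fix p q :: "nat \<Rightarrow> nat"
  assume "p \<in> {p. p permutes {1..n}}" "q \<in> {p. p permutes {1..n}}"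
  then have pq: "p permutes {1..n}" "q permutes {1..n}" by auto
  have "p = q" if "map (\<lambda>i. int (p i)) [1..<Suc n] = map (\<lambda>i. int (q i)) [1..<Suc n]"
  proof
    fix i show "p i = q i"
      using that permutes_not_in[OF pq(1)] permutes_not_in[OF pq(2)]
      by (cases "i \<in> {1..n}") (auto simp del: upt_Suc)
  qed
  then show "(map (\<lambda>i. int (p i)) [1..<Suc n] = map (\<lambda>i. int (q i)) [1..<Suc n]) = (p = q)" by blast
next
  fix p :: "nat \<Rightarrow> nat"
  assume "p \<in> {p. p permutes {1..n}}"
  then have p: "p permutes {1..n}" by simp
  have eq: "set [1..<Suc n] = {1..n}" by auto
  have im: "p ` {1..n} = {1..n}" using permutes_image[OF p] .
  have "int ` {1..n} = {1..int n}" using image_int_atLeastAtMost[of 1 n] by simp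
  then have st: "set (map (\<lambda>i. int (p i)) [1..<Suc n]) = {1..int n}"
    unfolding set_map eq by (metis im image_image)
  have "distinct (map (\<lambda>i. int (p i)) [1..<Suc n])"
    unfolding distinct_map using permutes_inj_on[OF p] by (auto simp: inj_on_def)
  moreover have "map abs (map (\<lambda>i. int (p i)) [1..<Suc n]) = map (\<lambda>i. int (p i)) [1..<Suc n]"
    by simp
  moreover have "abs ` {1..int n} = {1..int n}" "sgn ` {1..int n} \<subseteq> {1}" by auto
  ultimately show "map (\<lambda>i. int (p i)) [1..<Suc n] \<in> signed_words {1} n"
    unfolding signed_words_def mem_Collect_eq st by metis
next
  fix l assume l: "l \<in> signed_words {1} n"
  have len: "length l = n" using length_signed_words[OF l] .
  have pos: "1 \<le> l ! i \<and> l ! i \<le> int n" if "i < n" for i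
  proof -
    have "l ! i \<in> set l" using that len by simp
    then have "sgn (l ! i) = 1" "1 \<le> \<bar>l ! i\<bar>" "\<bar>l ! i\<bar> \<le> int n"
      using l abs_signed_words[OF l] by (auto simp: signed_words_def)
    then show ?thesis by (auto simp: sgn_if split: if_splits)
  qed
  have dist: "distinct l" using l by (auto simp: signed_words_def distinct_map)
  \<comment> \<open>List positions start at 0 and arguments of \<open>p\<close> at 1. Since all
    letters are positive, \<open>nat\<close> loses nothing.\<close>
  define p where "p i = (if i \<in> {1..n} then nat (l ! (i - 1)) else i)" for i
  have sub: "p ` {1..n} \<subseteq> {1..n}"
  proof clarify
    fix i assume "i \<in> {1..n}"
    then have i: "p i = nat (l ! (i - 1))" and "i - 1 < n" by (auto simp: p_def)
    from pos[OF this(2)] show "p i \<in> {1..n}" unfolding i atLeastAtMost_iff by linarith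
  qed
  have inj: "inj_on p {1..n}"
  proof (rule inj_onI)
    fix i j assume ij: "i \<in> {1..n}" "j \<in> {1..n}" "p i = p j"
    then have e: "nat (l ! (i - 1)) = nat (l ! (j - 1))" and "i - 1 < n" "j - 1 < n"
      by (auto simp: p_def)
    from e pos[OF this(2)] pos[OF this(3)] have "l ! (i - 1) = l ! (j - 1)" by linarith
    then have "i - 1 = j - 1" using ij dist len by (subst (asm) nth_eq_iff_index_eq) auto
    then show "i = j" using ij by auto
  qed
  have "p permutes {1..n}"
    using endo_inj_surj[OF _ sub inj] inj
    by (intro bij_imp_permutes) (auto simp: bij_betw_def p_def)
  moreover have "0 \<le> l ! i" if "i < n" for i
    using pos[OF that] by simp
  then have "l = map (\<lambda>i. int (p i)) [1..<Suc n]"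
    using len by (intro nth_equalityI) (auto simp: p_def simp del: upt_Suc)
  ultimately show "\<exists>p \<in> {p. p permutes {1..n}}. l = map (\<lambda>i. int (p i)) [1..<Suc n]" by blast
qed

text \<open>A signed permutation is odd and fixes everything outside its support, so its values on
  1, ..., n determine it.\<close>

lemma bij_betw_signed_perms_signed_words:
  "bij_betw (\<lambda>p. map (\<lambda>i. p (int i)) [1..<Suc n]) (signed_perms n) (signed_words {1, -1} n)"
proof (rule bij_betwI')
  fix p q
  assume "p \<in> signed_perms n" "q \<in> signed_perms n"
  then have p: "p permutes ({- int n..int n} - {0})" and q: "q permutes ({- int n..int n} - {0})"
    and po: "\<And>i. i \<in> {- int n..int n} - {0} \<Longrightarrow> p (- i) = - p i"
    and qo: "\<And>i. i \<in> {- int n..int n} - {0} \<Longrightarrow> q (- i) = - q i"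
    by (auto simp: signed_perms_def)
  have "p = q" if eq: "map (\<lambda>i. p (int i)) [1..<Suc n] = map (\<lambda>i. q (int i)) [1..<Suc n]"
  proof
    have e: "p (int i) = q (int i)" if "1 \<le> i" "i \<le> n" for i
      using eq that by (auto simp del: upt_Suc)
    have pos: "p i = q i" if "1 \<le> i" "i \<le> int n" for i
      using e[of "nat i"] that by simp
    fix i
    consider "i \<notin> {- int n..int n} - {0}" | "1 \<le> i" "i \<le> int n" | "1 \<le> - i" "- i \<le> int n"
      by fastforce
    then show "p i = q i"
    proof cases
      case 1
      then show ?thesis using permutes_not_in[OF p] permutes_not_in[OF q] by metis
    next
      case 2
      then show ?thesis by (rule pos)
    next
      case 3
      then show ?thesis using pos[of "- i"] po[of "- i"] qo[of "- i"] by auto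
    qed
  qed
  then show "(map (\<lambda>i. p (int i)) [1..<Suc n] = map (\<lambda>i. q (int i)) [1..<Suc n]) = (p = q)" by blast
next
  fix p assume ps: "p \<in> signed_perms n"
  let ?T = "{- int n..int n} - {0}"
  have p: "p permutes ?T" and po: "\<And>i. i \<in> ?T \<Longrightarrow> p (- i) = - p i"
    using ps by (auto simp: signed_perms_def)
  have inT: "p (int i) \<in> ?T" if "i \<in> {1..n}" for i
    using permutes_in_image[OF p, of "int i"] that by auto
  have eq: "set [1..<Suc n] = {1..n}" by auto
  \<comment> \<open>By oddness, equal absolute values at i and j mean that \<open>p\<close> agrees
    at i and j or at i and -j; the latter is impossible for positive i and j.\<close>
  have inj: "inj_on (\<lambda>i. \<bar>p (int i)\<bar>) {1..n}"
  proof (rule inj_onI)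
    fix i j assume ij: "i \<in> {1..n}" "j \<in> {1..n}" and "\<bar>p (int i)\<bar> = \<bar>p (int j)\<bar>"
    moreover have "p (- int j) = - p (int j)" using ij by (intro po) auto
    ultimately consider "p (int i) = p (int j)" | "p (int i) = p (- int j)"
      by linarith
    then show "i = j"
    proof cases
      case 1
      then have "int i = int j" by (rule injD[OF permutes_inj[OF p]])
      then show ?thesis by simp
    next
      case 2
      then have "int i = - int j" by (rule injD[OF permutes_inj[OF p]])
      then show ?thesis using ij by auto
    qed
  qed
  have d: "distinct (map abs (map (\<lambda>i. p (int i)) [1..<Suc n]))"
    unfolding map_map distinct_map eq using inj by (simp add: o_def)
  have sub: "(\<lambda>i. \<bar>p (int i)\<bar>) ` {1..n} \<subseteq> {1..int n}"
    using inT by force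
  have "(\<lambda>i. \<bar>p (int i)\<bar>) ` {1..n} = {1..int n}"
  proof (rule card_subset_eq[OF _ sub])
    show "card ((\<lambda>i. \<bar>p (int i)\<bar>) ` {1..n}) = card {1..int n}"
      by (simp only: card_image[OF inj]) simp
  qed simp
  then have "abs ` set (map (\<lambda>i. p (int i)) [1..<Suc n]) = {1..int n}"
    unfolding set_map eq by (simp add: image_image)
  moreover have "sgn ` set (map (\<lambda>i. p (int i)) [1..<Suc n]) \<subseteq> {1, -1}"
    unfolding set_map eq using inT by (auto simp: sgn_if)
  ultimately show "map (\<lambda>i. p (int i)) [1..<Suc n] \<in> signed_words {1, -1} n"
    using d unfolding signed_words_def by blast
next
  fix l assume l: "l \<in> signed_words {1, -1} n"
  let ?T = "{- int n..int n} - {0}"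
  have len: "length l = n" using length_signed_words[OF l] .
  have bd: "1 \<le> \<bar>l ! i\<bar> \<and> \<bar>l ! i\<bar> \<le> int n" if "i < n" for i
    using abs_signed_words[OF l, of "l ! i"] that len by simp
  have dist: "distinct (map abs l)" using l by (auto simp: signed_words_def)
  \<comment> \<open>The odd extension of the word to negative arguments.\<close>
  define p where "p i = (if i \<in> ?T then sgn i * l ! (nat \<bar>i\<bar> - 1) else i)" for i
  have absp: "\<bar>p i\<bar> = \<bar>l ! (nat \<bar>i\<bar> - 1)\<bar>" "1 \<le> \<bar>p i\<bar>" "\<bar>p i\<bar> \<le> int n" if "i \<in> ?T" for i
  proof -
    have "\<bar>sgn i\<bar> = 1" using that by (auto simp: sgn_if)
    then show a: "\<bar>p i\<bar> = \<bar>l ! (nat \<bar>i\<bar> - 1)\<bar>" unfolding p_def using that by (simp add: abs_mult)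
    have "nat \<bar>i\<bar> - 1 < n" using that by auto
    from bd[OF this] show "1 \<le> \<bar>p i\<bar>" "\<bar>p i\<bar> \<le> int n" unfolding a by auto
  qed
  have sub: "p ` ?T \<subseteq> ?T"
  proof (rule image_subsetI)
    fix i assume "i \<in> ?T"
    from absp(2,3)[OF this] have "p i \<noteq> 0" "- int n \<le> p i" "p i \<le> int n" by linarith+
    then show "p i \<in> ?T" by simp
  qed
  have inj: "inj_on p ?T"
  proof (rule inj_onI)
    fix i j assume ij: "i \<in> ?T" "j \<in> ?T" and pe: "p i = p j"
    have k: "nat \<bar>i\<bar> - 1 < n" "nat \<bar>j\<bar> - 1 < n" using ij by auto
    \<comment> \<open>Distinctness of the absolute values yields equal absolute values of i and j;
      cancelling the common nonzero letter then yields equal signs.\<close>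
    have "map abs l ! (nat \<bar>i\<bar> - 1) = map abs l ! (nat \<bar>j\<bar> - 1)"
      using absp(1)[OF ij(1)] absp(1)[OF ij(2)] pe k len by simp
    then have e: "(nat \<bar>i\<bar> - 1) = (nat \<bar>j\<bar> - 1)"
      using dist len k by (subst (asm) nth_eq_iff_index_eq) auto
    have "p i = sgn i * l ! (nat \<bar>i\<bar> - 1)" "p j = sgn j * l ! (nat \<bar>j\<bar> - 1)"
      unfolding p_def using ij by (simp_all only: if_True)
    then have "sgn i * l ! (nat \<bar>i\<bar> - 1) = sgn j * l ! (nat \<bar>i\<bar> - 1)"
      unfolding e using pe by (simp only:)
    moreover have "l ! (nat \<bar>i\<bar> - 1) \<noteq> 0" using bd[OF k(1)] by linarith
    ultimately have "sgn i = sgn j" using mult_right_cancel by blast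
    moreover have "nat \<bar>i\<bar> \<noteq> 0" "nat \<bar>j\<bar> \<noteq> 0" using ij by simp_all
    then have "\<bar>i\<bar> = \<bar>j\<bar>" using e by linarith
    ultimately show "i = j" by (metis mult_sgn_abs)
  qed
  have "p permutes ?T"
    using endo_inj_surj[OF _ sub inj] inj
    by (intro bij_imp_permutes) (auto simp: bij_betw_def p_def)
  moreover have "p (- i) = - p i" if "i \<in> ?T" for i
    using that by (auto simp: p_def sgn_minus)
  ultimately have "p \<in> signed_perms n" by (auto simp: signed_perms_def)
  moreover have "l = map (\<lambda>i. p (int i)) [1..<Suc n]"
    using len by (intro nth_equalityI) (auto simp: p_def nat_add_distrib simp del: upt_Suc)
  ultimately show "\<exists>p \<in> signed_perms n. l = map (\<lambda>i. p (int i)) [1..<Suc n]" by blast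
qed

text \<open>The leading 0 is \<open>p 0\<close>, so list index and argument coincide. It lies below
  all other letters, whence position 0 is never a descent.\<close>

lemma eulerian_A_eq_word_poly: "eulerian_A n = word_poly {1} n"
proof -
  have "list_des (0 # map (\<lambda>i. int (p i)) [1..<Suc n]) = des_A n p" if p: "p permutes {1..n}" for p
  proof -
    have p0: "p 0 = 0" using permutes_not_in[OF p, of 0] by simp
    have l: "0 # map (\<lambda>i. int (p i)) [1..<Suc n] = map (\<lambda>i. int (p i)) [0..<Suc n]"
      by (subst (2) upt_conv_Cons) (use p0 in auto)
    have "{i. Suc i < Suc n \<and> map (\<lambda>i. int (p i)) [0..<Suc n] ! i > map (\<lambda>i. int (p i)) [0..<Suc n] ! Suc i}
      = {i \<in> {1..<n}. p i > p (i + 1)}" (is "?L = ?R")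
    proof (rule set_eqI)
      fix i show "i \<in> ?L \<longleftrightarrow> i \<in> ?R"
        using p0 by (cases i) (auto simp del: upt_Suc)
    qed
    then show ?thesis unfolding l list_des_conv_card des_A_def by simp
  qed
  then show ?thesis
    unfolding eulerian_A_def word_poly_def
    by (subst sum.reindex_bij_betw[OF bij_betw_permutes_signed_words, symmetric]) simp
qed

text \<open>Here the leading 0 matters: position 0 is a descent exactly when the first letter is
  negative, as type B demands.\<close>

lemma eulerian_B_eq_word_poly: "eulerian_B n = word_poly {1, -1} n"
proof -
  have "list_des (0 # map (\<lambda>i. p (int i)) [1..<Suc n]) = des_B n p" if "p \<in> signed_perms n" for p
  proof -
    have p: "p permutes ({- int n..int n} - {0})" using that by (simp add: signed_perms_def)
    have p0: "p 0 = 0" using permutes_not_in[OF p, of 0] by simp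
    have l: "0 # map (\<lambda>i. p (int i)) [1..<Suc n] = map (\<lambda>i. p (int i)) [0..<Suc n]"
      by (subst (2) upt_conv_Cons) (use p0 in auto)
    have "{i \<in> {0..<int n}. p i > p (i + 1)} = int ` {i. i < n \<and> p (int i) > p (int i + 1)}"
    proof (rule set_eqI, rule iffI)
      fix i assume "i \<in> {i \<in> {0..<int n}. p i > p (i + 1)}"
      then show "i \<in> int ` {i. i < n \<and> p (int i) > p (int i + 1)}"
        by (intro image_eqI[of _ _ "nat i"]) auto
    qed auto
    also have "{i. i < n \<and> p (int i) > p (int i + 1)} = {i. Suc i < Suc n \<and>
        map (\<lambda>i. p (int i)) [0..<Suc n] ! i > map (\<lambda>i. p (int i)) [0..<Suc n] ! Suc i}"
      by (auto simp: add.commute simp del: upt_Suc)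
    finally show ?thesis unfolding l list_des_conv_card des_B_def by (simp add: card_image)
  qed
  then show ?thesis
    unfolding eulerian_B_def word_poly_def
    by (subst sum.reindex_bij_betw[OF bij_betw_signed_perms_signed_words, symmetric]) simp
qed

section \<open>Uniqueness of gamma expansions\<close>

text \<open>The polynomial x^k (1+x)^(d-2k) has lowest term x^k, so the system is triangular with
  unit diagonal and the coefficients can be compared one after the other.\<close>

lemma gamma_expansion_unique:
  fixes c c' :: "nat \<Rightarrow> real"
  assumes c: "\<forall>k > d div 2. c k = 0" and c': "\<forall>k > d div 2. c' k = 0"
    and eq: "(\<Sum>k = 0..d div 2. smult (c k) (monom 1 k * [:1, 1:] ^ (d - 2 * k)))
       = (\<Sum>k = 0..d div 2. smult (c' k) (monom 1 k * [:1, 1:] ^ (d - 2 * k)))"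
  shows "c = c'"
proof
  fix k show "c k = c' k"
  proof (induction k rule: less_induct)
    case (less k)
    show ?case
    proof (cases "k \<le> d div 2")
      case True
      have co: "coeff (monom 1 j * [:1, 1:] ^ (d - 2 * j) :: real poly) k
          = (if j > k then 0 else if j = k then 1 else coeff ([:1, 1:] ^ (d - 2 * j)) (k - j))" for j
        by (auto simp: coeff_monom_mult coeff_0_power)
      have "(\<Sum>j = 0..d div 2. (c j - c' j) * coeff (monom 1 j * [:1, 1:] ^ (d - 2 * j) :: real poly) k) = 0"
        using arg_cong[OF eq, of "\<lambda>p. coeff p k"]
        by (simp add: coeff_sum left_diff_distrib sum_subtractf)
      \<comment> \<open>Terms with j < k vanish by the induction hypothesis, terms with j > k
        because they are divisible by x^(k+1).\<close>
      also have "(\<Sum>j = 0..d div 2. (c j - c' j) * coeff (monom 1 j * [:1, 1:] ^ (d - 2 * j) :: real poly) k)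
        = (\<Sum>j = 0..d div 2. if j = k then c k - c' k else 0)"
        using less by (intro sum.cong) (auto simp: co)
      finally show ?thesis using True by simp
    qed (use c c' in auto)
  qed
qed

text \<open>Replaces the definite description by an identity of values at all real points, where the
  Eulerian recurrences are available.\<close>

lemma gamma_vector_eqI:
  fixes c :: "nat \<Rightarrow> real"
  assumes c: "\<forall>k > d div 2. c k = 0"
    and q: "\<And>y. poly q y = (\<Sum>k = 0..d div 2. c k * (y ^ k * (1 + y) ^ (d - 2 * k)))"
  shows "gamma_vector d q = c"
proof -
  have "poly q = poly (\<Sum>k = 0..d div 2. smult (c k) (monom 1 k * [:1, 1:] ^ (d - 2 * k)))"
    by (rule ext) (simp add: q poly_sum poly_monom poly_power)
  then have "q = (\<Sum>k = 0..d div 2. smult (c k) (monom 1 k * [:1, 1:] ^ (d - 2 * k)))"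
    by (simp add: poly_eq_poly_eq_iff)
  then show ?thesis
    unfolding gamma_vector_def using c gamma_expansion_unique
    by (intro the_equality) auto
qed

section \<open>Triangular recurrences and the gamma-vectors of the Coxeter complexes\<close>

text \<open>Common form of both Coxeter cases: weights 2k+1 and 4 will give b(n,k), weights k+1 and
  2 will give a(n+1,k).\<close>

fun rec_coeff :: "(nat \<Rightarrow> real) \<Rightarrow> real \<Rightarrow> nat \<Rightarrow> nat \<Rightarrow> real" where
  "rec_coeff \<alpha> \<beta> 0 k = (if k = 0 then 1 else 0)"
| "rec_coeff \<alpha> \<beta> (Suc n) 0 = \<alpha> 0 * rec_coeff \<alpha> \<beta> n 0"
| "rec_coeff \<alpha> \<beta> (Suc n) (Suc k) =
     \<alpha> (Suc k) * rec_coeff \<alpha> \<beta> n (Suc k) + \<beta> * (real n - 2 * real k) * rec_coeff \<alpha> \<beta> n k"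

text \<open>The support could outgrow its bound only through a step from column k = n/2, where the
  factor n-2k vanishes.\<close>

lemma rec_coeff_eq_0: "k > n div 2 \<Longrightarrow> rec_coeff \<alpha> \<beta> n k = 0"
proof (induction \<alpha> \<beta> n k rule: rec_coeff.induct)
  case (3 \<alpha> \<beta> n k)
  show ?case
  proof (cases "k > n div 2")
    case True
    then show ?thesis using 3 by simp
  next
    case False
    with 3(3) have "n = 2 * k" by linarith
    then show ?thesis using 3 by simp
  qed
qed auto

text \<open>Collecting the coefficient of each \<open>E k\<close>. With \<open>E\<close> left
  abstract, this serves both the polynomial basis and the monomials in f and g.\<close>

lemma sum_shift_coeff:
  fixes c c' E :: "nat \<Rightarrow> real"
  assumes c: "\<forall>k > n div 2. c k = 0" 
    and c0: "c' 0 = \<alpha> 0 * c 0"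
    and cS: "\<And>k. c' (Suc k) = \<alpha> (Suc k) * c (Suc k) + \<beta> * (real n - 2 * real k) * c k"
  shows "(\<Sum>k = 0..n div 2. c k * (\<alpha> k * E k + \<beta> * (real n - 2 * real k) * E (Suc k)))
    = (\<Sum>k = 0..Suc n div 2. c' k * E k)"
proof -
  let ?m = "n div 2"
  let ?g = "\<lambda>k. \<beta> * (real n - 2 * real k) * c k"
  \<comment> \<open>For even n the right-hand sum has one extra index, n/2 + 1, whose coefficient is
    zero.\<close>
  have "(\<Sum>k = 0..Suc n div 2. c' k * E k) = (\<Sum>k = 0..Suc ?m. c' k * E k)"
  proof (cases "even n")
    case True
    then have "c' (Suc ?m) = 0" using c cS[of ?m] by (auto elim: evenE)
    then show ?thesis using True by simp
  next
    case False
    then have "Suc n div 2 = Suc ?m" by (auto elim: oddE)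
    then show ?thesis by simp
  qed
  also have "\<dots> = c' 0 * E 0 + (\<Sum>k = 0..?m. c' (Suc k) * E (Suc k))"
    by (simp add: sum.atLeast0_atMost_Suc_shift del: sum.cl_ivl_Suc)
  also have "\<dots> = \<alpha> 0 * c 0 * E 0 + (\<Sum>k = 0..?m. \<alpha> (Suc k) * c (Suc k) * E (Suc k))
      + (\<Sum>k = 0..?m. ?g k * E (Suc k))"
    by (simp add: c0 cS sum.distrib ring_distribs)
  also have "\<alpha> 0 * c 0 * E 0 + (\<Sum>k = 0..?m. \<alpha> (Suc k) * c (Suc k) * E (Suc k))
      = (\<Sum>k = 0..Suc ?m. \<alpha> k * c k * E k)"
    by (simp add: sum.atLeast0_atMost_Suc_shift del: sum.cl_ivl_Suc)
  also have "\<dots> = (\<Sum>k = 0..?m. \<alpha> k * c k * E k)" using c by simp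
  finally show ?thesis by (simp add: sum.distrib[symmetric] algebra_simps)
qed

text \<open>Type A is t = 1 and type B is t = 2. With m = d-2k, the operator sends y^k (1+y)^m to
  (tk+1) y^k (1+y)^(m+1) + 2tm y^(k+1) (1+y)^(m-1).\<close>

lemma rec_coeff_gamma_expansion_Suc:
  fixes t :: real
  assumes p: "\<And>y. poly p y =
      (\<Sum>k = 0..d div 2. rec_coeff (\<lambda>k. t * k + 1) (2 * t) d k * (y ^ k * (1 + y) ^ (d - 2 * k)))"
    and q: "\<And>y. poly q y = (1 + (t * d + 1) * y) * poly p y + t * (1 - y) * (y * poly (pderiv p) y)"
  shows "poly q y = (\<Sum>k = 0..Suc d div 2.
      rec_coeff (\<lambda>k. t * k + 1) (2 * t) (Suc d) k * (y ^ k * (1 + y) ^ (Suc d - 2 * k)))"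
proof -
  let ?c = "rec_coeff (\<lambda>k. t * k + 1) (2 * t) d"
  let ?D = "\<lambda>k. real k * y ^ (k - 1) * (1 + y) ^ (d - 2 * k)
    + y ^ k * (real (d - 2 * k) * (1 + y) ^ (d - 2 * k - 1))"
  \<comment> \<open>The formal derivative of \<open>p\<close> is found by differentiating its values
    and using uniqueness of derivatives.\<close>
  have "((\<lambda>y. \<Sum>k = 0..d div 2. ?c k * (y ^ k * (1 + y) ^ (d - 2 * k))) has_real_derivative
      (\<Sum>k = 0..d div 2. ?c k * ?D k)) (at y)"
    by (auto intro!: derivative_eq_intros sum.cong)
  then have "poly (pderiv p) y = (\<Sum>k = 0..d div 2. ?c k * ?D k)"
    using DERIV_unique poly_DERIV unfolding p[abs_def, symmetric] by blast
  then have "poly q y = (\<Sum>k = 0..d div 2. ?c k *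
      ((1 + (t * d + 1) * y) * (y ^ k * (1 + y) ^ (d - 2 * k)) + t * (1 - y) * (y * ?D k)))"
    unfolding q p by (simp add: sum_distrib_left sum.distrib[symmetric] algebra_simps)
  also have "\<dots> = (\<Sum>k = 0..d div 2. ?c k * ((t * k + 1) * (y ^ k * (1 + y) ^ (Suc d - 2 * k))
      + 2 * t * (real d - 2 * real k) * (y ^ Suc k * (1 + y) ^ (Suc d - 2 * Suc k))))"
  proof (intro sum.cong refl arg_cong2[where f = "(*)"])
    fix k assume "k \<in> {0..d div 2}"
    \<comment> \<open>Writing d = 2k+m removes the truncated differences; for m = 0 the term with
      exponent m-1 has coefficient 0.\<close>
    then obtain m where d: "d = 2 * k + m" by (metis atLeastAtMost_iff div_times_less_eq_dividend
      le_iff_add le_trans mult.commute mult_le_mono1)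
    have yk: "y * (real k * y ^ (k - 1)) = real k * y ^ k" by (cases k) auto
    have D: "y * ?D k = real k * y ^ k * (1 + y) ^ m + y ^ k * (y * (real m * (1 + y) ^ (m - 1)))"
      using yk unfolding d by (simp add: distrib_left) (metis mult.assoc mult.left_commute)
    show "(1 + (t * d + 1) * y) * (y ^ k * (1 + y) ^ (d - 2 * k)) + t * (1 - y) * (y * ?D k)
      = (t * k + 1) * (y ^ k * (1 + y) ^ (Suc d - 2 * k))
        + 2 * t * (real d - 2 * real k) * (y ^ Suc k * (1 + y) ^ (Suc d - 2 * Suc k))"
      unfolding D unfolding d by (cases m) (simp_all add: algebra_simps)
  qed
  also have "\<dots> = (\<Sum>k = 0..Suc d div 2.
      rec_coeff (\<lambda>k. t * k + 1) (2 * t) (Suc d) k * (y ^ k * (1 + y) ^ (Suc d - 2 * k)))"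
    by (rule sum_shift_coeff) (simp_all add: rec_coeff_eq_0)
  finally show ?thesis .
qed

lemma gamma_b_eq_rec_coeff: "gamma_b n = rec_coeff (\<lambda>k. 2 * real k + 1) 4 n"
proof -
  \<comment> \<open>The form \<open>2 * 2\<close> displays t = 2 for unification with the step
    lemma.\<close>
  have "poly (word_poly {1, -1} n) y = (\<Sum>k = 0..n div 2.
      rec_coeff (\<lambda>k. 2 * real k + 1) (2 * 2) n k * (y ^ k * (1 + y) ^ (n - 2 * k)))" for y
  proof (induction n arbitrary: y)
    case 0
    then show ?case by (simp add: word_poly_0)
  next
    case (Suc n)
    show ?case
      by (rule rec_coeff_gamma_expansion_Suc[OF Suc]) (simp add: poly_word_poly_B_Suc)
  qed
  then show ?thesis
    unfolding gamma_b_def eulerian_B_eq_word_poly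
    by (intro gamma_vector_eqI) (simp_all add: rec_coeff_eq_0)
qed

text \<open>The index is shifted since the expansion of A_n has d = n-1; row 0 belongs to A_1 =
  1.\<close>

lemma gamma_a_Suc_eq_rec_coeff: "gamma_a (Suc n) = rec_coeff (\<lambda>k. real k + 1) 2 n"
proof -
  have "poly (word_poly {1} (Suc n)) y = (\<Sum>k = 0..n div 2.
      rec_coeff (\<lambda>k. 1 * real k + 1) (2 * 1) n k * (y ^ k * (1 + y) ^ (n - 2 * k)))" for y
  proof (induction n arbitrary: y)
    case 0
    then show ?case by (simp add: poly_word_poly_A_Suc word_poly_0)
  next
    case (Suc n)
    show ?case
      by (rule rec_coeff_gamma_expansion_Suc[OF Suc]) (simp add: poly_word_poly_A_Suc[of "Suc n"])
  qed
  then show ?thesis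
    unfolding gamma_a_def eulerian_A_eq_word_poly
    by (intro gamma_vector_eqI) (simp_all add: rec_coeff_eq_0)
qed

section \<open>Binomial recurrences for the gamma-vectors of the associahedra\<close>

lemma of_nat_Suc_times_binomial_Suc:
  "(real k + 1) * real (n choose Suc k) = (real n - real k) * real (n choose k)"
proof (cases "k \<le> n")
  case True
  have "Suc k * (n choose Suc k) = (n - k) * (n choose k)"
    using binomial_absorb_comp[of n k] binomial_absorption[of k n] by simp
  then have "real (Suc k * (n choose Suc k)) = real ((n - k) * (n choose k))" by simp
  then show ?thesis using True by (simp add: of_nat_diff algebra_simps)
qed (simp add: binomial_eq_0)

text \<open>By Pascal's rule and symmetry, C(2k+2,k+1) = 2 C(2k+1,k), and C(2k+1,k) is C(2k,k) times
  (2k+1)/(k+1).\<close>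

lemma central_binomial_Suc:
  "(real k + 1) * real ((2 * Suc k) choose Suc k) = 2 * (2 * real k + 1) * real ((2 * k) choose k)"
proof -
  have a: "(real k + 1) * real ((2 * k) choose Suc k) = real k * real ((2 * k) choose k)"
    using of_nat_Suc_times_binomial_Suc[of k "2 * k"] by simp
  have b: "real ((2 * Suc k) choose Suc k) = 2 * real (Suc (2 * k) choose k)"
    using binomial_symmetric[of "Suc k" "Suc (2 * k)"] by simp
  have c: "real (Suc (2 * k) choose Suc k) = real (Suc (2 * k) choose k)"
    using binomial_symmetric[of "Suc k" "Suc (2 * k)"] by simp
  have "(real k + 1) * real (Suc (2 * k) choose k) = (2 * real k + 1) * real ((2 * k) choose k)"
    unfolding c[symmetric] using a by (simp add: algebra_simps)
  then show ?thesis unfolding b by (simp add: algebra_simps)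
qed

text \<open>This is what fD demands of H: the left factor n+1 turns n! into (n+1)!. All binomials
  are rational multiples of C(n,2k) and C(2k,k), which leaves an identity of rational
  functions.\<close>

lemma gamma_H_Suc:
  "(real n + 1) * gamma_H (Suc n) (Suc k) =
     (real n + 1 + 2 * real (Suc k)) * gamma_H n (Suc k) + 4 * (real n - 2 * real k) * gamma_H n k"
proof -
  define X where "X = real (n choose (2 * k))"
  define C where "C = real ((2 * k) choose k)"
  define m where "m = real n - 2 * real k"
  have n: "real n = m + 2 * real k" by (simp add: m_def)
  have X1: "real (n choose Suc (2 * k)) = m * X / (2 * real k + 1)"
    using of_nat_Suc_times_binomial_Suc[of "2 * k" n] by (simp add: m_def X_def field_simps)
  have X2: "real (n choose Suc (Suc (2 * k))) = (m - 1) * (m * X / (2 * real k + 1)) / (2 * real k + 2)"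
    using of_nat_Suc_times_binomial_Suc[of "Suc (2 * k)" n] unfolding X1[symmetric]
    by (simp add: m_def field_simps)
  have C: "real ((2 * Suc k) choose Suc k) = 2 * (2 * real k + 1) * C / (real k + 1)"
    using central_binomial_Suc[of k] by (simp add: C_def field_simps)
  have N1: "real (Suc n choose (2 * Suc k)) = m * X / (2 * real k + 1)
      + (m - 1) * (m * X / (2 * real k + 1)) / (2 * real k + 2)"
    using X1 X2 by simp
  have N2: "real (n choose (2 * Suc k)) = (m - 1) * (m * X / (2 * real k + 1)) / (2 * real k + 2)"
    using X2 by simp
  show ?thesis
    unfolding gamma_H_def N1 N2 C X_def[symmetric] C_def[symmetric] n
    by (simp add: divide_simps) algebra
qed

text \<open>The analogue for order m+1 of (fD)(g): the left factor m+3 turns (m+2)! into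
  (m+3)!.\<close>

lemma gamma_F_Suc:
  "(real m + 3) * gamma_F (Suc (Suc m)) (Suc k) =
     (real m + 3 + 2 * real (Suc k)) * gamma_F (Suc m) (Suc k)
     + 4 * (real m - 2 * real k) * gamma_F (Suc m) k"
proof -
  define X where "X = real (m choose (2 * k))"
  define C where "C = real ((2 * k) choose k)"
  define r where "r = real m - 2 * real k"
  have m: "real m = r + 2 * real k" by (simp add: r_def)
  have X1: "real (m choose Suc (2 * k)) = r * X / (2 * real k + 1)"
    using of_nat_Suc_times_binomial_Suc[of "2 * k" m] by (simp add: r_def X_def field_simps)
  have X2: "real (m choose Suc (Suc (2 * k))) = (r - 1) * (r * X / (2 * real k + 1)) / (2 * real k + 2)"
    using of_nat_Suc_times_binomial_Suc[of "Suc (2 * k)" m] unfolding X1[symmetric]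
    by (simp add: r_def field_simps)
  have C: "real ((2 * Suc k) choose Suc k) = 2 * (2 * real k + 1) * C / (real k + 1)"
    using central_binomial_Suc[of k] by (simp add: C_def field_simps)
  have N1: "real (Suc m choose (2 * Suc k)) = r * X / (2 * real k + 1)
      + (r - 1) * (r * X / (2 * real k + 1)) / (2 * real k + 2)"
    using X1 X2 by simp
  have N2: "real (m choose (2 * Suc k)) = (r - 1) * (r * X / (2 * real k + 1)) / (2 * real k + 2)"
    using X2 by simp
  show ?thesis
    unfolding gamma_F_def catalan_number_def diff_Suc_1 N1 N2 C C_def[symmetric] X_def[symmetric] m
    by (simp add: divide_simps) algebra
qed

section \<open>Differentiating sums of monomials in f and g\<close>

text \<open>The product rule gives weights a+2k and 4(n-2k). The offset \<open>a\<close> will be 1,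
  2, n+1 and m+3 in the four identities.\<close>

lemma DERIV_gamma_sum:
  fixes F G :: "real \<Rightarrow> real" and c c' :: "nat \<Rightarrow> real"
  assumes F: "(F has_real_derivative F x * G x) (at x)"
    and G: "(G has_real_derivative 4 * F x ^ 2) (at x)"
    and c: "\<forall>k > n div 2. c k = 0"
    and c0: "c' 0 = real a * c 0"
    and cS: "\<And>k. c' (Suc k) = real (a + 2 * Suc k) * c (Suc k) + 4 * (real n - 2 * real k) * c k"
  shows "((\<lambda>y. \<Sum>k = 0..n div 2. c k * (F y ^ (a + 2 * k) * G y ^ (n - 2 * k)))
      has_real_derivative
      (\<Sum>k = 0..Suc n div 2. c' k * (F x ^ (a + 2 * k) * G x ^ (Suc n - 2 * k)))) (at x)"
proof -
  let ?D = "\<lambda>k. real (a + 2 * k) * (F x ^ (a + 2 * k) * G x ^ (Suc n - 2 * k))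
      + 4 * (real n - 2 * real k) * (F x ^ (a + 2 * Suc k) * G x ^ (Suc n - 2 * Suc k))"
  have "((\<lambda>y. c k * (F y ^ (a + 2 * k) * G y ^ (n - 2 * k))) has_real_derivative c k * ?D k) (at x)"
    if "k \<in> {0..n div 2}" for k
  proof -
    from that obtain m where n: "n = 2 * k + m" by (metis atLeastAtMost_iff div_times_less_eq_dividend
      le_iff_add le_trans mult.commute mult_le_mono1)
    have F': "((\<lambda>y. F y ^ e) has_real_derivative real e * F x ^ e * G x) (at x)" for e
      by (rule DERIV_cong[OF DERIV_power[OF F]]) (cases e; simp)
    have G': "((\<lambda>y. G y ^ m) has_real_derivative real m * G x ^ (m - 1) * (4 * F x ^ 2)) (at x)"
      by (auto intro!: derivative_eq_intros G)
    have "n - 2 * k = m" using n by simp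
    then show ?thesis
      by (simp only:) (rule DERIV_cong[OF DERIV_cmult[OF DERIV_mult[OF F' G']]],
        cases m, simp_all add: n algebra_simps power2_eq_square)
  qed
  then have "((\<lambda>y. \<Sum>k = 0..n div 2. c k * (F y ^ (a + 2 * k) * G y ^ (n - 2 * k)))
      has_real_derivative (\<Sum>k = 0..n div 2. c k * ?D k)) (at x)"
    by (rule DERIV_sum)
  also have "(\<Sum>k = 0..n div 2. c k * ?D k)
      = (\<Sum>k = 0..Suc n div 2. c' k * (F x ^ (a + 2 * k) * G x ^ (Suc n - 2 * k)))"
    using c c0 cS by (intro sum_shift_coeff) simp_all
  finally show ?thesis .
qed

text \<open>Needed because the closed forms of the iterated derivatives are only established where
  cos(2y) is nonzero.\<close>

lemma deriv_eqI_open: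
  fixes \<phi> \<psi> :: "real \<Rightarrow> real"
  assumes "open S" "x \<in> S" "\<And>y. y \<in> S \<Longrightarrow> \<phi> y = \<psi> y" "(\<psi> has_real_derivative D) (at x)"
  shows "deriv \<phi> x = D"
  using has_field_derivative_transform_within_open[OF assms(4,1,2), of \<phi>] assms(3)
  by (intro DERIV_imp_deriv) simp

section \<open>The four identities by induction on the order\<close>

theorem theorem6:
  fixes f g :: "real \<Rightarrow> real" and n :: nat and x :: real
  assumes f: "f = (\<lambda>x. 1 / cos (2 * x))"
    and g: "g = (\<lambda>x. 2 * tan (2 * x))"
    and n: "n \<ge> 1"
    and x: "cos (2 * x) \<noteq> 0"
  shows "(deriv ^^ n) f x =
           (\<Sum>k = 0..n div 2. gamma_b n k * f x ^ (2 * k + 1) * g x ^ (n - 2 * k))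
    \<and> (deriv ^^ n) g x =
           2 ^ (n + 1) *
           (\<Sum>k = 0..(n - 1) div 2. gamma_a n k * f x ^ (2 * k + 2) * g x ^ (n - 1 - 2 * k))
    \<and> (mult_deriv f ^^ n) f x =
           fact n * (\<Sum>k = 0..n div 2. gamma_H n k * f x ^ (n + 1 + 2 * k) * g x ^ (n - 2 * k))
    \<and> (mult_deriv f ^^ n) g x =
           2 * fact (n + 1) *
           (\<Sum>k = 0..(n - 1) div 2. gamma_F n k * f x ^ (n + 2 + 2 * k) * g x ^ (n - 1 - 2 * k))"
proof -
  define S where "S = {y :: real. cos (2 * y) \<noteq> 0}"
  have opn: "open S" unfolding S_def by (intro open_Collect_neq continuous_intros)
  have xS: "x \<in> S" using x by (simp add: S_def)
  have Df: "(f has_real_derivative f y * g y) (at y)" if "y \<in> S" for y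
    using that unfolding f g S_def
    by (auto intro!: derivative_eq_intros simp: tan_def power2_eq_square)
  have Dg: "(g has_real_derivative 4 * f y ^ 2) (at y)" if "y \<in> S" for y
    using that unfolding f g S_def
    by (auto intro!: derivative_eq_intros simp: power2_eq_square field_simps)
  \<comment> \<open>Shared induction step; \<kappa> is the constant in front of the sum. The formula
    is assumed on all of \<open>S\<close>, since differentiation at \<open>y\<close> uses a
    neighbourhood.\<close>
  have step: "deriv \<phi> y = \<kappa> * (\<Sum>k = 0..Suc m div 2. c' k * (f y ^ (a + 2 * k) * g y ^ (Suc m - 2 * k)))"
    if y: "y \<in> S"
      and eq: "\<And>z. z \<in> S \<Longrightarrow> \<phi> z = \<kappa> * (\<Sum>k = 0..m div 2. c k * (f z ^ (a + 2 * k) * g z ^ (m - 2 * k)))"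
      and c: "\<forall>k > m div 2. c k = 0" "c' 0 = real a * c 0"
        "\<And>k. c' (Suc k) = real (a + 2 * Suc k) * c (Suc k) + 4 * (real m - 2 * real k) * c k"
    for \<phi> y \<kappa> a m and c c' :: "nat \<Rightarrow> real"
    using eq DERIV_cmult[OF DERIV_gamma_sum[OF Df[OF y] Dg[OF y] c]]
    by (rule deriv_eqI_open[OF opn y])
  have mult_deriv_apply: "mult_deriv f \<phi> y = f y * deriv \<phi> y" for \<phi> y
    by (simp add: mult_deriv_def)
  obtain m where m: "n = Suc m" using n by (cases n) auto
  have dg: "deriv g y = 4 * f y ^ 2" if "y \<in> S" for y
    using Dg[OF that] by (rule DERIV_imp_deriv)
  have 1: "(deriv ^^ n) f y = 1 * (\<Sum>k = 0..n div 2. gamma_b n k * (f y ^ (1 + 2 * k) * g y ^ (n - 2 * k)))"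
    if "y \<in> S" for y using that
  proof (induction n arbitrary: y)
    case 0
    then show ?case by (simp add: gamma_b_eq_rec_coeff)
  next
    case (Suc n)
    show ?case unfolding funpow.simps o_apply
      by (rule step[OF Suc.prems Suc.IH]) (simp_all add: gamma_b_eq_rec_coeff rec_coeff_eq_0)
  qed
  \<comment> \<open>The induction starts at order one, where D(g) = 4 f^2, because a(n,k) starts at
    n = 1.\<close>
  have 2: "(deriv ^^ Suc m) g y = 2 ^ (m + 2) *
      (\<Sum>k = 0..m div 2. gamma_a (Suc m) k * (f y ^ (2 + 2 * k) * g y ^ (m - 2 * k)))"
    if "y \<in> S" for y using that
  proof (induction m arbitrary: y)
    case 0
    then show ?case by (simp add: gamma_a_Suc_eq_rec_coeff dg)
  next
    case (Suc m)
    \<comment> \<open>The weights 2k+2 and 4 are twice the weights k+1 and 2 of a(n,k); this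
      accounts for the growing power of 2.\<close>
    have "(deriv ^^ Suc (Suc m)) g y = 2 ^ (m + 2) * (\<Sum>k = 0..Suc m div 2.
        2 * gamma_a (Suc (Suc m)) k * (f y ^ (2 + 2 * k) * g y ^ (Suc m - 2 * k)))"
      unfolding funpow.simps(2)[of "Suc m"] o_apply
      by (rule step[OF Suc.prems Suc.IH])
        (simp_all add: gamma_a_Suc_eq_rec_coeff rec_coeff_eq_0 algebra_simps)
    then show ?case by (simp add: sum_distrib_left mult.assoc mult.left_commute)
  qed
  have 3: "(mult_deriv f ^^ n) f y = fact n *
      (\<Sum>k = 0..n div 2. gamma_H n k * (f y ^ ((n + 1) + 2 * k) * g y ^ (n - 2 * k)))"
    if "y \<in> S" for y using that
  proof (induction n arbitrary: y)
    case 0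
    then show ?case by (simp add: gamma_H_def)
  next
    case (Suc n)
    \<comment> \<open>Only D is applied here, so the exponents of f still start at n+1. The factor f
      that follows raises them by one, and n+1 joins n!.\<close>
    have D: "deriv ((mult_deriv f ^^ n) f) y = fact n * (\<Sum>k = 0..Suc n div 2.
        ((real n + 1) * gamma_H (Suc n) k) * (f y ^ ((n + 1) + 2 * k) * g y ^ (Suc n - 2 * k)))"
    proof (rule step[OF Suc.prems Suc.IH])
      show "\<forall>k > n div 2. gamma_H n k = 0" by (auto simp: gamma_H_def binomial_eq_0)
    qed (simp_all add: gamma_H_Suc, simp_all add: gamma_H_def algebra_simps)
    show ?case
      by (subst funpow.simps, subst o_apply, subst mult_deriv_apply, subst D,
        unfold sum_distrib_left, intro sum.cong refl, simp add: algebra_simps)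
  qed
  \<comment> \<open>At order one, f D(g) = 4 f^3, which is the prefactor 2 * 2! times f^3.\<close>
  have 4: "(mult_deriv f ^^ Suc m) g y = 2 * fact (m + 2) *
      (\<Sum>k = 0..m div 2. gamma_F (Suc m) k * (f y ^ ((m + 3) + 2 * k) * g y ^ (m - 2 * k)))"
    if "y \<in> S" for y using that
  proof (induction m arbitrary: y)
    case 0
    then show ?case by (simp add: gamma_F_def catalan_number_def mult_deriv_def dg eval_nat_numeral)
  next
    case (Suc m)
    have D: "deriv ((mult_deriv f ^^ Suc m) g) y = 2 * fact (m + 2) * (\<Sum>k = 0..Suc m div 2.
        ((real m + 3) * gamma_F (Suc (Suc m)) k) * (f y ^ ((m + 3) + 2 * k) * g y ^ (Suc m - 2 * k)))"
    proof (rule step[OF Suc.prems Suc.IH])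
      show "\<forall>k > m div 2. gamma_F (Suc m) k = 0" by (auto simp: gamma_F_def binomial_eq_0)
    qed (simp_all add: gamma_F_Suc, simp_all add: gamma_F_def algebra_simps)
    have fct: "fact (Suc m + 2) = (real m + 3) * fact (m + 2)"
      by simp
    have pow: "f y ^ (Suc m + 3 + 2 * k) = f y * f y ^ (m + 3 + 2 * k)" for k
      by (simp only: add_Suc power_Suc)
    show ?case
      by (subst funpow.simps, subst o_apply, subst mult_deriv_apply, subst D,
        unfold sum_distrib_left fct pow, intro sum.cong refl, simp only: ac_simps)
  qed
  have shift: "m + 2 = n + 1" "m + 3 = n + 2" "Suc m = n" "m = n - 1" using m by simp_all
  show ?thesis
    using 1[OF xS] 2[OF xS, unfolded shift(1,3)] 3[OF xS] 4[OF xS, unfolded shift(1-3)]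
    unfolding shift(4) by (simp only: ac_simps mult_1)
qed

end
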